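(* Let $A\in\mathbb{R}^{n\times n}$, $B\in\mathbb{R}^{n\times 1}$ and $C\in\mathbb{R}^{p\times n}$, and assume that the pair $(A,B)$ is controllable. Then there exists a finite set $F\subset\mathbb{C}$ such that for any choice of $n$ numbers $\lambda_1,\dots,\lambda_n\in\mathbb{C}\setminus F$ such that the $\lambda_i$'s have distinct magnitudes, there exists $K\in\mathbb{R}^{1\times n}$ such that: (1) the eigenvalues of the closed-loop matrix $A+BK$ are $\lambda_1,\dots,\lambda_n$; and (2) the number of correctable errors after $n$ steps for the pair $(A+BK,C)$ is maximal (equal to $\lceil p/2-1\rceil$).
   Context: For $x\in\mathbb{R}^p$, $\mathrm{supp}(x)=\{i : x_i\neq 0\}$. Given a pair $(A',C)\in\mathbb{R}^{n\times n}\times\mathbb{R}^{p\times n}$ and integers $T\ge1$, $q\ge0$, we say that $q$ errors are correctable after $T$ steps for $(A',C)$ if there is a function (decoder) $D:(\mathbb{R}^p)^T\to\mathbb{R}^n$ such that for every $x^{(0)}\in\mathbb{R}^n$ and every $e^{(0)},\dots,e^{(T-1)}\in\mathbb{R}^p$ for which there is $S\subset\{1,\dots,p\}$ with $|S|\le q$ and $\mathrm{supp}(e^{(t)})\subset S$ for all $t$, we have $D(y^{(0)},\dots,y^{(T-1)})=x^{(0)}$, where $y^{(t)}=C(A')^t x^{(0)}+e^{(t)}$, $t=0,\dots,T-1$. The number of correctable errors after $T$ steps is the largest $q$ such that $q$ errors are correctable after $T$ steps; it is always less than $p/2$. The pair $(A,B)$ is controllable if $[B, AB,\dots,A^{n-1}B]$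 has rank $n$.
   Formalization: Added: the λ_i are closed under complex conjugation (so, having distinct magnitudes, real), and C has more than 2⌈p/2−1⌉ nonzero rows; n, p ≥ 1. Each of the first two is implied by the conclusion; without them the claim fails, e.g. for a single non-real λ_1 or for C = 0. *)

theory Defs
  imports "Jordan_Normal_Form.Spectral_Radius" "Jordan_Normal_Form.DL_Rank"
begin

text \<open>
  Dimensions are read off the matrices, and coordinates, time steps and list positions are
  numbered from 0.
\<close>

definition supp_vec :: "real vec \<Rightarrow> nat set" where
  "supp_vec x = {i. i < dim_vec x \<and> x $ i \<noteq> 0}"

definition controllability_mat :: "real mat \<Rightarrow> real mat \<Rightarrow> real mat" where
  "controllability_mat A B =
     mat_of_cols (dim_row A) (concat (map (\<lambda>k. cols (A ^\<^sub>m k * B)) [0..<dim_row A]))"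

definition controllable :: "real mat \<Rightarrow> real mat \<Rightarrow> bool" where
  "controllable A B \<longleftrightarrow> vec_space.rank (dim_row A) (controllability_mat A B) = dim_row A"

text \<open>
  A tuple of \<open>T\<close> measurements is a list of length \<open>T\<close>. The values of the decoder \<open>D\<close> on
  lists that do not arise as measurements are irrelevant, so \<open>D\<close> is not relativised to
  carriers. The error support \<open>S\<close> is unknown to \<open>D\<close> but is the same at all time steps.
\<close>

definition errors_correctable :: "real mat \<Rightarrow> real mat \<Rightarrow> nat \<Rightarrow> nat \<Rightarrow> bool" where
  "errors_correctable A C T q \<longleftrightarrow>
     (\<exists>D :: real vec list \<Rightarrow> real vec.
        \<forall>x \<in> carrier_vec (dim_row A). \<forall>e :: nat \<Rightarrow> real vec.
          (\<forall>t<T. e t \<in> carrier_vec (dim_row C)) \<longrightarrow>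
          (\<exists>S \<subseteq> {..<dim_row C}. card S \<le> q \<and> (\<forall>t<T. supp_vec (e t) \<subseteq> S)) \<longrightarrow>
          D (map (\<lambda>t. (C * A ^\<^sub>m t) *\<^sub>v x + e t) [0..<T]) = x)"

text \<open>
  Stated as a relation because a largest \<open>q\<close> need not exist: if \<open>(A, C)\<close> is not observable,
  not even \<open>q = 0\<close> errors are correctable.
\<close>

definition is_num_correctable_errors :: "real mat \<Rightarrow> real mat \<Rightarrow> nat \<Rightarrow> nat \<Rightarrow> bool" where
  "is_num_correctable_errors A C T q \<longleftrightarrow>
     errors_correctable A C T q \<and> (\<forall>q'. errors_correctable A C T q' \<longrightarrow> q' \<le> q)"

end

theory Submission
  imports Defs
begin

text \<open>
  Write \<open>b\<close> for the only column of \<open>B\<close> and \<open>P\<close> for the monic polynomial of degree \<open>n\<close> with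
  \<open>P(A) b = 0\<close>. The vector \<open>u(x) = P(x) (x I - A)\<^sup>-\<^sup>1 b\<close> is polynomial in \<open>x\<close>, and by controllability
  \<open>w \<bullet> u(x)\<close> is a nonzero polynomial of degree less than \<open>n\<close> whenever \<open>w\<close> is nonzero. Hence
  \<open>u(l\<^sub>1), \<dots>, u(l\<^sub>n)\<close> are linearly independent for distinct \<open>l\<^sub>i\<close>, and the feedback \<open>K\<close> with
  \<open>K u(l\<^sub>i) = P(l\<^sub>i)\<close> makes them eigenvectors of \<open>A + B K\<close>. Let \<open>F\<close> consist of the roots of
  \<open>c \<bullet> u(x)\<close> for the nonzero rows \<open>c\<close> of \<open>C\<close>. Outside \<open>F\<close> no such row annihilates an eigenvector,
  so by the invertibility of the Vandermonde matrix every nonzero initial state is seen by each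
  nonzero row of \<open>C\<close> within \<open>n\<close> steps. An error set and its alternative together cover at most
  \<open>2 q\<close> rows, so they cannot explain the difference of two initial states.
\<close>

section \<open>Correctable errors and support sizes\<close>

text \<open>Two initial states explaining the same measurements differ by a vector whose outputs
  vanish outside the union of two error supports, hence on all but at most \<open>2 * q\<close>
  coordinates. By \<open>wide\<close> this vector is zero.\<close>

lemma errors_correctableI:
  fixes A C :: "real mat"
  assumes A: "A \<in> carrier_mat n n" and C: "C \<in> carrier_mat p n"
    and wide: "\<And>x. x \<in> carrier_vec n \<Longrightarrow> x \<noteq> 0\<^sub>v n \<Longrightarrow>
      2 * q < card {j. j < p \<and> (\<exists>t<T. ((C * A ^\<^sub>m t) *\<^sub>v x) $ j \<noteq> 0)}"
  shows "errors_correctable A C T q"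
proof -
  define ok where "ok x e \<longleftrightarrow> x \<in> carrier_vec n \<and> (\<forall>t<T. e t \<in> carrier_vec p) \<and>
    (\<exists>S \<subseteq> {..<p}. card S \<le> q \<and> (\<forall>t<T. supp_vec (e t) \<subseteq> S))"
    for x :: "real vec" and e :: "nat \<Rightarrow> real vec"
  define Y where "Y x e = map (\<lambda>t. (C * A ^\<^sub>m t) *\<^sub>v x + e t) [0..<T]"
    for x :: "real vec" and e :: "nat \<Rightarrow> real vec"
  have M: "C * A ^\<^sub>m t \<in> carrier_mat p n" for t
    using A C pow_carrier_mat[OF A] by auto
  have unique: "x = x'" if ok: "ok x e" "ok x' e'" and Y: "Y x e = Y x' e'" for x x' e e'
  proof (rule ccontr)
    assume neq: "x \<noteq> x'"
    have x: "x \<in> carrier_vec n" "x' \<in> carrier_vec n" using ok unfolding ok_def by auto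
    obtain S where S: "S \<subseteq> {..<p}" "card S \<le> q" "\<forall>t<T. supp_vec (e t) \<subseteq> S"
      using ok(1) unfolding ok_def by auto
    obtain S' where S': "S' \<subseteq> {..<p}" "card S' \<le> q" "\<forall>t<T. supp_vec (e' t) \<subseteq> S'"
      using ok(2) unfolding ok_def by auto
    have "x - x' \<noteq> 0\<^sub>v n"
    proof
      assume z: "x - x' = 0\<^sub>v n"
      have "x $ i = x' $ i" if "i < n" for i
        using arg_cong[OF z, of "\<lambda>v. v $ i"] that x by auto
      with x neq show False by (metis carrier_vecD eq_vecI)
    qed
    with x have "2 * q < card {j. j < p \<and> (\<exists>t<T. ((C * A ^\<^sub>m t) *\<^sub>v (x - x')) $ j \<noteq> 0)}"
      (is "_ < card ?J") by (intro wide) auto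
    also have "?J \<subseteq> S \<union> S'"
    proof
      fix j assume "j \<in> ?J"
      then obtain t where j: "j < p" and t: "t < T"
        and nz: "((C * A ^\<^sub>m t) *\<^sub>v (x - x')) $ j \<noteq> 0" by auto
      have e: "e t \<in> carrier_vec p" "e' t \<in> carrier_vec p" using ok t unfolding ok_def by auto
      have "Y x e ! t = Y x' e' ! t" using Y by simp
      then have "(C * A ^\<^sub>m t) *\<^sub>v x + e t = (C * A ^\<^sub>m t) *\<^sub>v x' + e' t"
        using t by (simp add: Y_def)
      then have "((C * A ^\<^sub>m t) *\<^sub>v x + e t) $ j = ((C * A ^\<^sub>m t) *\<^sub>v x' + e' t) $ j" by simp
      moreover have "((C * A ^\<^sub>m t) *\<^sub>v (x - x')) $ j
          = ((C * A ^\<^sub>m t) *\<^sub>v x) $ j - ((C * A ^\<^sub>m t) *\<^sub>v x') $ j"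
        using mult_minus_distrib_mat_vec[OF M x] M[of t] j
        by (metis carrier_matD(1) dim_mult_mat_vec index_minus_vec(1))
      ultimately have "e t $ j \<noteq> 0 \<or> e' t $ j \<noteq> 0"
        using nz e j by auto
      then show "j \<in> S \<union> S'" using S(3) S'(3) t j e unfolding supp_vec_def by fastforce
    qed
    then have "card ?J \<le> card (S \<union> S')"
      using S(1) S'(1) by (intro card_mono) (auto intro: finite_subset)
    also have "\<dots> \<le> 2 * q" using card_Un_le[of S S'] S(2) S'(2) by simp
    finally show False by simp
  qed
  \<comment> \<open>The decoder picks any state consistent with the data; \<open>unique\<close>
    makes the pick the true one.\<close>
  define D where "D y = (SOME x. \<exists>e. ok x e \<and> Y x e = y)" for y
  have "D (Y x e) = x" if "ok x e" for x e
  proof -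
    have "\<exists>e'. ok (D (Y x e)) e' \<and> Y (D (Y x e)) e' = Y x e"
      unfolding D_def by (rule someI[of _ x]) (use that in blast)
    then show ?thesis using unique that by blast
  qed
  then show ?thesis
    using A C unfolding errors_correctable_def ok_def Y_def by (intro exI[of _ D]) auto
qed

text \<open>Otherwise a full measurement could be split into two halves of size at most \<open>q\<close>, and
  zero would be confused with any nonzero initial state.\<close>

lemma errors_correctable_imp_less:
  fixes A C :: "real mat"
  assumes A: "A \<in> carrier_mat n n" and C: "C \<in> carrier_mat p n" and n: "n \<ge> 1"
    and corr: "errors_correctable A C T q"
  shows "2 * q < p"
proof (rule ccontr)
  assume "\<not> 2 * q < p"
  then have pq: "p - q \<le> q" by simp
  obtain D where D: "\<forall>x \<in> carrier_vec n. \<forall>e. (\<forall>t<T. e t \<in> carrier_vec p) \<longrightarrow>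
      (\<exists>S \<subseteq> {..<p}. card S \<le> q \<and> (\<forall>t<T. supp_vec (e t) \<subseteq> S)) \<longrightarrow>
      D (map (\<lambda>t. (C * A ^\<^sub>m t) *\<^sub>v x + e t) [0..<T]) = (x :: real vec)"
    using corr A C unfolding errors_correctable_def by auto
  define x :: "real vec" where "x = unit_vec n 0"
  have x: "x \<in> carrier_vec n" "x \<noteq> 0\<^sub>v n" using n by (auto simp: x_def)
  have M: "C * A ^\<^sub>m t \<in> carrier_mat p n" for t
    using A C pow_carrier_mat[OF A] by auto
  define y where "y t = (C * A ^\<^sub>m t) *\<^sub>v x" for t
  have y: "y t \<in> carrier_vec p" for t using M x(1) unfolding y_def by (rule mult_mat_vec_carrier)
  \<comment> \<open>Both errors lead to \<open>y t\<close> with its first \<open>q\<close> entries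
    erased: \<open>e\<close> cancels them starting from \<open>x\<close>, \<open>e'\<close> fakes
    the others starting from zero. As \<open>q\<close> may exceed \<open>p\<close>, the support of
    \<open>e\<close> is taken as \<open>{..<min p q}\<close>.\<close>
  define e where "e t = vec p (\<lambda>j. if j < q then - y t $ j else 0)" for t
  define e' where "e' t = vec p (\<lambda>j. if j < q then 0 else y t $ j)" for t
  have "D (map (\<lambda>t. (C * A ^\<^sub>m t) *\<^sub>v x + e t) [0..<T]) = x"
    by (rule D[rule_format, OF x(1)])
      (auto simp: e_def supp_vec_def split: if_splits intro!: exI[of _ "{..<min p q}"])
  moreover have "D (map (\<lambda>t. (C * A ^\<^sub>m t) *\<^sub>v 0\<^sub>v n + e' t) [0..<T]) = 0\<^sub>v n"
    using pq by (intro D[rule_format])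
      (auto simp: e'_def supp_vec_def split: if_splits intro!: exI[of _ "{q..<p}"])
  moreover have "(C * A ^\<^sub>m t) *\<^sub>v x + e t = (C * A ^\<^sub>m t) *\<^sub>v 0\<^sub>v n + e' t" for t
  proof -
    have "N *\<^sub>v 0\<^sub>v n = 0\<^sub>v p" if "N \<in> carrier_mat p n" for N :: "real mat"
      using that by (intro eq_vecI) auto
    from this[OF M] show ?thesis using y[of t] unfolding y_def[symmetric]
      by (intro eq_vecI) (auto simp: e_def e'_def)
  qed
  ultimately show False using x by simp
qed

section \<open>Vandermonde systems and monic families\<close>

text \<open>Weighting the equations with the coefficients of the unnormalised Lagrange polynomial
  \<open>L\<close>, which vanishes at every node except \<open>l i\<close>, isolates
  \<open>\<beta> i\<close>.\<close>

lemma vandermonde_kernel: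
  fixes l \<beta> :: "nat \<Rightarrow> 'a :: field"
  assumes inj: "inj_on l {..<n}"
    and zero: "\<And>t. t < n \<Longrightarrow> (\<Sum>i<n. \<beta> i * l i ^ t) = 0"
    and i: "i < n"
  shows "\<beta> i = 0"
proof -
  define L where "L = (\<Prod>j\<in>{..<n} - {i}. [:- l j, 1:])"
  have "degree L \<le> (\<Sum>j\<in>{..<n} - {i}. degree [:- l j, 1:])"
    unfolding L_def using degree_prod_sum_le[of "{..<n} - {i}" "\<lambda>j. [:- l j, 1:]"]
    by (simp add: o_def)
  also have "\<dots> = n - 1" using i by simp
  finally have deg: "degree L < n" using i by simp
  have L: "poly L (l k) = (\<Prod>j\<in>{..<n} - {i}. l k - l j)" for k
    unfolding L_def by (simp add: poly_prod)
  have eval: "poly L x = (\<Sum>t<n. coeff L t * x ^ t)" for x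
    unfolding poly_altdef using deg
    by (intro sum.mono_neutral_left) (auto simp: coeff_eq_0)
  have "(\<Sum>k<n. \<beta> k * poly L (l k)) = (\<Sum>k<n. \<Sum>t<n. coeff L t * (\<beta> k * l k ^ t))"
    by (simp add: eval sum_distrib_left mult_ac)
  also have "\<dots> = (\<Sum>t<n. coeff L t * (\<Sum>k<n. \<beta> k * l k ^ t))"
    by (subst sum.swap) (simp add: sum_distrib_left)
  also have "\<dots> = 0" by (simp add: zero)
  finally have "(\<Sum>k<n. \<beta> k * poly L (l k)) = 0" .
  moreover have "poly L (l k) = 0" if "k < n" "k \<noteq> i" for k
    unfolding L using that by (intro prod_zero) auto
  then have "(\<Sum>k<n. \<beta> k * poly L (l k)) = \<beta> i * poly L (l i)"
    using i by (subst sum.remove[of _ i]) auto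
  moreover have "poly L (l i) \<noteq> 0"
    unfolding L using inj i by (auto dest: inj_onD)
  ultimately show ?thesis by simp
qed

text \<open>The degrees are distinct, so at the largest index \<open>m\<close> with
  \<open>c m \<noteq> 0\<close> nothing can cancel the coefficient \<open>c m\<close>.\<close>

lemma sum_smult_monic_nonzero:
  fixes G :: "nat \<Rightarrow> 'a :: comm_ring_1 poly"
  assumes G: "\<And>k. k < n \<Longrightarrow> degree (G k) = k \<and> lead_coeff (G k) = 1"
    and zero: "(\<Sum>k<n. Polynomial.smult (c k) (G k)) = 0" and k: "k < n"
  shows "c k = 0"
proof (rule ccontr)
  assume "c k \<noteq> 0"
  define m where "m = Max {k. k < n \<and> c k \<noteq> 0}"
  have ne: "{k. k < n \<and> c k \<noteq> 0} \<noteq> {}" using k \<open>c k \<noteq> 0\<close> by auto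
  have m: "m < n" "c m \<noteq> 0" using Max_in[OF _ ne] unfolding m_def by auto
  have above: "c j = 0" if "m < j" "j < n" for j
    using Max_ge[of "{k. k < n \<and> c k \<noteq> 0}" j] that unfolding m_def[symmetric] by auto
  have "coeff (Polynomial.smult (c j) (G j)) m = (if j = m then c m else 0)" if "j < n" for j
    using G[OF that] above[of j] that
    by (cases j m rule: linorder_cases) (auto simp: coeff_eq_0)
  then have "coeff (\<Sum>k<n. Polynomial.smult (c k) (G k)) m = c m"
    using m by (simp add: coeff_sum)
  with zero m show False by simp
qed

section \<open>Horner polynomials and the resolvent\<close>

text \<open>For \<open>P = X ^ n + (\<Sum>i<n. a i * X ^ i)\<close>, the polynomial \<open>horner a n k\<close> is the \<open>k\<close>-th
  intermediate result of Horner's scheme, and \<open>horner a n n = P\<close>. The intermediate results are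
  the coefficients of \<open>(P(X) - P(Y)) / (X - Y)\<close> with respect to \<open>Y\<close>.\<close>

fun horner :: "(nat \<Rightarrow> 'a :: comm_ring_1) \<Rightarrow> nat \<Rightarrow> nat \<Rightarrow> 'a poly" where
  "horner a n 0 = 1"
| "horner a n (Suc k) = pCons (a (n - Suc k)) (horner a n k)"

lemma horner_monic:
  "degree (horner a n k) = k \<and> lead_coeff (horner a n k) = 1"
proof (induction k)
  case (Suc k)
  then have "horner a n k \<noteq> 0" by auto
  moreover have "coeff (horner a n k) k = 1" using Suc by metis
  ultimately show ?case using Suc by simp
qed simp

text \<open>This is P(x) - P(Y) = (x - Y) Q(x, Y), with Q the Horner sum, under the linear
  functional sending Y^j to \<open>s j\<close>. The assumption says that the functional kills
  P(Y).\<close>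

lemma horner_recurrence:
  fixes a s :: "nat \<Rightarrow> 'a :: comm_ring_1"
  assumes s: "s n = - (\<Sum>i<n. a i * s i)"
  shows "(\<Sum>k<n. poly (horner a n k) x * s (n - k)) + poly (horner a n n) x * s 0
    = x * (\<Sum>k<n. poly (horner a n k) x * s (n - Suc k))"
proof -
  let ?g = "\<lambda>k. poly (horner a n k) x"
  have "(\<Sum>k<n. ?g k * s (n - k)) + ?g n * s 0 = (\<Sum>k<Suc n. ?g k * s (n - k))" by simp
  also have "\<dots> = s n + (\<Sum>k<n. ?g (Suc k) * s (n - Suc k))"
    by (subst sum.lessThan_Suc_shift) simp
  also have "(\<Sum>k<n. ?g (Suc k) * s (n - Suc k)) =
      (\<Sum>k<n. a (n - Suc k) * s (n - Suc k)) + x * (\<Sum>k<n. ?g k * s (n - Suc k))"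
    by (simp add: sum_distrib_left sum.distrib algebra_simps)
  also have "(\<Sum>k<n. a (n - Suc k) * s (n - Suc k)) = (\<Sum>i<n. a i * s i)"
    by (rule sum.nat_diff_reindex)
  finally show ?thesis using s by simp
qed

definition krylov :: "'a :: comm_ring_1 mat \<Rightarrow> 'a vec \<Rightarrow> nat \<Rightarrow> 'a vec" where
  "krylov A b k = (A ^\<^sub>m k) *\<^sub>v b"

text \<open>Up to the factor \<open>poly (horner a n n) x\<close> this is the resolvent of \<open>A\<close> at \<open>x\<close> applied
  to \<open>b\<close>, see \<open>resolvent_vec_eq\<close>; unlike the resolvent, it is polynomial in \<open>x\<close>.\<close>

definition resolvent_vec ::
  "'a :: comm_ring_1 mat \<Rightarrow> 'a vec \<Rightarrow> (nat \<Rightarrow> 'a) \<Rightarrow> nat \<Rightarrow> 'a \<Rightarrow> 'a vec" where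
  "resolvent_vec A b a n x =
     vec n (\<lambda>i. \<Sum>k<n. poly (horner a n k) x * krylov A b (n - Suc k) $ i)"

text \<open>If \<open>a\<close> satisfies the relation for \<open>krylov A b n\<close>, this is the
  numerator of the transfer function w (x I - A)^-1 b over the denominator
  \<open>horner a n n\<close>. As a formal polynomial it has a degree that bounds its roots.\<close>

definition resolvent_poly ::
  "'a :: comm_ring_1 mat \<Rightarrow> 'a vec \<Rightarrow> (nat \<Rightarrow> 'a) \<Rightarrow> nat \<Rightarrow> 'a vec \<Rightarrow> 'a poly" where
  "resolvent_poly A b a n w =
     (\<Sum>k<n. Polynomial.smult (w \<bullet> krylov A b (n - Suc k)) (horner a n k))"

lemma krylov_carrier:
  "A \<in> carrier_mat n n \<Longrightarrow> b \<in> carrier_vec n \<Longrightarrow> krylov A b k \<in> carrier_vec n"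
  unfolding krylov_def by (rule mult_mat_vec_carrier[OF pow_carrier_mat])

lemma krylov_Suc:
  assumes A: "A \<in> carrier_mat n n" and b: "b \<in> carrier_vec n"
  shows "A *\<^sub>v krylov A b k = krylov A b (Suc k)"
proof -
  \<comment> \<open>\<open>pow_mat\<close> adds the new factor on the right; here it is needed on
    the left.\<close>
  have "A ^\<^sub>m Suc k = A * A ^\<^sub>m k"
  proof (induction k)
    case (Suc k)
    then show ?case
      using assoc_mult_mat[OF A pow_carrier_mat[OF A] A, of k] by simp
  qed (use A in simp)
  then show ?thesis
    unfolding krylov_def using assoc_mult_mat_vec[OF A pow_carrier_mat[OF A] b] by simp
qed

lemma resolvent_vec_carrier: "resolvent_vec A b a n x \<in> carrier_vec n"
  unfolding resolvent_vec_def by simp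

lemma scalar_prod_resolvent_vec:
  assumes A: "A \<in> carrier_mat n n" and b: "b \<in> carrier_vec n" and w: "w \<in> carrier_vec n"
  shows "w \<bullet> resolvent_vec A b a n x = poly (resolvent_poly A b a n w) x"
proof -
  have dim: "dim_vec (krylov A b k) = n" for k using krylov_carrier[OF A b] by auto
  have "w \<bullet> resolvent_vec A b a n x =
      (\<Sum>i = 0..<n. \<Sum>k<n. poly (horner a n k) x * (w $ i * krylov A b (n - Suc k) $ i))"
    by (simp add: scalar_prod_def resolvent_vec_def sum_distrib_left mult_ac)
  also have "\<dots> = (\<Sum>k<n. poly (horner a n k) x * (w \<bullet> krylov A b (n - Suc k)))"
    by (subst sum.swap) (simp add: scalar_prod_def dim sum_distrib_left)
  also have "\<dots> = poly (resolvent_poly A b a n w) x"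
    by (simp add: resolvent_poly_def poly_sum mult_ac)
  finally show ?thesis .
qed

text \<open>Multiplication by \<open>A\<close> shifts the Krylov index, so each coordinate is an
  instance of \<open>horner_recurrence\<close>.\<close>

lemma resolvent_vec_eq:
  assumes A: "A \<in> carrier_mat n n" and b: "b \<in> carrier_vec n"
    and rec: "\<And>i. i < n \<Longrightarrow> krylov A b n $ i = - (\<Sum>j<n. a j * krylov A b j $ i)"
  shows "A *\<^sub>v resolvent_vec A b a n x + poly (horner a n n) x \<cdot>\<^sub>v b
    = x \<cdot>\<^sub>v resolvent_vec A b a n x"
proof (rule eq_vecI)
  fix i assume "i < dim_vec (x \<cdot>\<^sub>v resolvent_vec A b a n x)"
  then have i: "i < n" by (simp add: resolvent_vec_def)
  have row: "row A i \<in> carrier_vec n" using A i by auto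
  have "row A i \<bullet> krylov A b (n - Suc k) = krylov A b (n - k) $ i" if "k < n" for k
    using krylov_Suc[OF A b, of "n - Suc k"] A i that
    by (metis Suc_diff_Suc carrier_matD(1) index_mult_mat_vec)
  then have "row A i \<bullet> resolvent_vec A b a n x
      = (\<Sum>k<n. poly (horner a n k) x * krylov A b (n - k) $ i)"
    unfolding scalar_prod_resolvent_vec[OF A b row] resolvent_poly_def
    by (simp add: poly_sum mult_ac)
  moreover have "krylov A b 0 = b" using A b by (simp add: krylov_def)
  moreover have "resolvent_vec A b a n x $ i
      = (\<Sum>k<n. poly (horner a n k) x * krylov A b (n - Suc k) $ i)"
    using i by (simp add: resolvent_vec_def)
  moreover note horner_recurrence[of "\<lambda>k. krylov A b k $ i" n a x, OF rec[OF i]]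
  ultimately have "row A i \<bullet> resolvent_vec A b a n x + poly (horner a n n) x * b $ i
      = x * resolvent_vec A b a n x $ i" by metis
  then show "(A *\<^sub>v resolvent_vec A b a n x + poly (horner a n n) x \<cdot>\<^sub>v b) $ i
      = (x \<cdot>\<^sub>v resolvent_vec A b a n x) $ i"
    using A b i resolvent_vec_carrier[of A b a n x] by simp
qed (use A b in \<open>simp add: resolvent_vec_def\<close>)

lemma degree_resolvent_poly: "n \<ge> 1 \<Longrightarrow> degree (resolvent_poly A b a n w) < n"
  unfolding resolvent_poly_def
  by (rule degree_sum_less)
    (auto intro: le_less_trans[OF Polynomial.degree_smult_le] simp: horner_monic)

text \<open>The Horner polynomials are monic of distinct degrees, so a zero combination would make
  \<open>w\<close> orthogonal to all Krylov vectors.\<close>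

lemma resolvent_poly_nonzero:
  assumes indep: "\<And>w. w \<in> carrier_vec n \<Longrightarrow> \<forall>k<n. w \<bullet> krylov A b k = 0 \<Longrightarrow> w = 0\<^sub>v n"
    and w: "w \<in> carrier_vec n" "w \<noteq> 0\<^sub>v n"
  shows "resolvent_poly A b a n w \<noteq> 0"
proof
  assume zero: "resolvent_poly A b a n w = 0"
  have "w \<bullet> krylov A b (n - Suc k) = 0" if "k < n" for k
    by (rule sum_smult_monic_nonzero[OF horner_monic zero[unfolded resolvent_poly_def] that])
  then have "w \<bullet> krylov A b (n - Suc (n - Suc k)) = 0" if "k < n" for k
    using that by (meson diff_less le_less_trans le0 zero_less_Suc)
  moreover have "n - Suc (n - Suc k) = k" if "k < n" for k
    using that by simp
  ultimately have "\<forall>k<n. w \<bullet> krylov A b k = 0" by simp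
  with indep w show False by blast
qed

section \<open>Controllable pairs\<close>

lemma det_nonzero_solve:
  fixes M :: "'a :: field mat"
  assumes M: "M \<in> carrier_mat n n" and det: "det M \<noteq> 0" and y: "y \<in> carrier_vec n"
  obtains x where "x \<in> carrier_vec n" "M *\<^sub>v x = y"
proof -
  obtain N where N: "N \<in> carrier_mat n n" "M * N = 1\<^sub>m n"
    using det_non_zero_imp_unit[OF M det, of "()"] unfolding Units_def ring_mat_def by auto
  have "M *\<^sub>v (N *\<^sub>v y) = y"
    using assoc_mult_mat_vec[OF M N(1) y] N(2) y by simp
  with that[of "N *\<^sub>v y"] N(1) y show ?thesis by auto
qed

lemma controllability_mat_single_input:
  assumes A: "A \<in> carrier_mat n n" and B: "B \<in> carrier_mat n 1"
  shows "controllability_mat A B = mat n n (\<lambda>(i, k). krylov A (col B 0) k $ i)"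
proof -
  have "concat (map (\<lambda>k. cols (A ^\<^sub>m k * B)) ks) = map (krylov A (col B 0)) ks" for ks
  proof (induction ks)
    case (Cons k ks)
    have AB: "A ^\<^sub>m k \<in> carrier_mat n n" using A by simp
    have "cols (A ^\<^sub>m k * B) = [krylov A (col B 0) k]"
      using B col_mult2[OF AB B, of 0] by (simp add: cols_def krylov_def)
    with Cons show ?case by simp
  qed simp
  then show ?thesis using A
    by (intro eq_matI) (auto simp: controllability_mat_def mat_of_cols_def)
qed

text \<open>Full rank makes the Krylov matrix invertible. Its transpose then has trivial kernel, and
  solving for \<open>krylov A b n\<close> yields the lower coefficients of P without
  Cayley-Hamilton.\<close>

lemma controllable_single_input:
  assumes A: "A \<in> carrier_mat n n" and B: "B \<in> carrier_mat n 1" and ctr: "controllable A B"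
  defines "b \<equiv> col B 0"
  shows controllable_krylov_indep:
      "\<And>w. w \<in> carrier_vec n \<Longrightarrow> \<forall>k<n. w \<bullet> krylov A b k = 0 \<Longrightarrow> w = 0\<^sub>v n"
    and controllable_krylov_dep:
      "\<exists>a. \<forall>i<n. krylov A b n $ i = - (\<Sum>j<n. a j * krylov A b j $ i)"
proof -
  define M where "M = mat n n (\<lambda>(i, k). krylov A b k $ i)"
  have M: "M \<in> carrier_mat n n" by (simp add: M_def)
  have b: "b \<in> carrier_vec n" using B by (auto simp: b_def)
  have kr: "krylov A b k \<in> carrier_vec n" for k using A b by (rule krylov_carrier)
  have "vec_space.rank n M = n"
    using ctr A unfolding controllable_def controllability_mat_single_input[OF A B]
    by (simp add: M_def b_def)
  then have det: "det M \<noteq> 0" using vec_space.det_rank_iff[OF M] by simp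
  show "w = 0\<^sub>v n" if w: "w \<in> carrier_vec n" and zero: "\<forall>k<n. w \<bullet> krylov A b k = 0" for w
  proof (rule ccontr)
    assume "w \<noteq> 0\<^sub>v n"
    moreover have "transpose_mat M *\<^sub>v w = 0\<^sub>v n"
    proof (rule eq_vecI)
      fix k assume "k < dim_vec (0\<^sub>v n :: real vec)"
      then have k: "k < n" by simp
      then have "col M k = krylov A b k" using kr[of k] by (intro eq_vecI) (auto simp: M_def)
      then show "(transpose_mat M *\<^sub>v w) $ k = 0\<^sub>v n $ k"
        using zero k M comm_scalar_prod[OF w kr[of k]] by simp
    qed (use M in simp)
    ultimately have "det (transpose_mat M) = 0"
      using det_0_iff_vec_prod_zero_field[of "transpose_mat M" n] M w by auto
    with det det_transpose[OF M] show False by simp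
  qed
  obtain x where x: "x \<in> carrier_vec n" "M *\<^sub>v x = krylov A b n"
    by (rule det_nonzero_solve[OF M det kr])
  have "krylov A b n $ i = - (\<Sum>j<n. - x $ j * krylov A b j $ i)" if "i < n" for i
    using that x(1) M unfolding x(2)[symmetric]
    by (simp add: scalar_prod_def M_def sum_negf mult_ac atLeast0LessThan)
  then show "\<exists>a. \<forall>i<n. krylov A b n $ i = - (\<Sum>j<n. a j * krylov A b j $ i)"
    by (intro exI[of _ "\<lambda>j. - x $ j"]) auto
qed

text \<open>Orthogonality to all \<open>v i\<close> means lying in the kernel of the matrix with
  these rows. This dual form of independence suits root counting.\<close>

lemma det_rows_nonzero:
  fixes v :: "nat \<Rightarrow> 'a :: field vec"
  assumes v: "\<And>i. i < n \<Longrightarrow> v i \<in> carrier_vec n"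
    and indep: "\<And>w. w \<in> carrier_vec n \<Longrightarrow> \<forall>i<n. w \<bullet> v i = 0 \<Longrightarrow> w = 0\<^sub>v n"
  shows "det (mat n n (\<lambda>(i, j). v i $ j)) \<noteq> 0"
proof
  define W where "W = mat n n (\<lambda>(i, j). v i $ j)"
  have W: "W \<in> carrier_mat n n" by (simp add: W_def)
  have row: "row W i = v i" if "i < n" for i
    using that v[OF that] by (intro eq_vecI) (auto simp: W_def)
  assume "det (mat n n (\<lambda>(i, j). v i $ j)) = 0"
  then obtain w where w: "w \<in> carrier_vec n" "w \<noteq> 0\<^sub>v n" "W *\<^sub>v w = 0\<^sub>v n"
    using det_0_iff_vec_prod_zero_field[OF W] by (auto simp: W_def)
  have "w \<bullet> v i = 0" if "i < n" for i
    using arg_cong[OF w(3), of "\<lambda>u. u $ i"] that W row[OF that]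
      comm_scalar_prod[OF w(1) v[OF that]] by simp
  with indep w show False by blast
qed

text \<open>The conditions \<open>k \<bullet> v i = \<mu> i\<close> form an invertible linear system
  for the single row \<open>k\<close> of the feedback, which then contributes exactly the term in
  \<open>\<mu> i\<close>.\<close>

lemma state_feedback_eigenvectors:
  fixes A B :: "'a :: field mat"
  assumes A: "A \<in> carrier_mat n n" and B: "B \<in> carrier_mat n 1"
    and v: "\<And>i. i < n \<Longrightarrow> v i \<in> carrier_vec n"
    and indep: "\<And>w. w \<in> carrier_vec n \<Longrightarrow> \<forall>i<n. w \<bullet> v i = 0 \<Longrightarrow> w = 0\<^sub>v n"
    and eq: "\<And>i. i < n \<Longrightarrow> A *\<^sub>v v i + \<mu> i \<cdot>\<^sub>v col B 0 = l i \<cdot>\<^sub>v v i"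
  obtains K where "K \<in> carrier_mat 1 n"
    "\<And>i. i < n \<Longrightarrow> (A + B * K) *\<^sub>v v i = l i \<cdot>\<^sub>v v i"
proof -
  define W where "W = mat n n (\<lambda>(i, j). v i $ j)"
  have W: "W \<in> carrier_mat n n" by (simp add: W_def)
  have Wrow: "row W i = v i" if "i < n" for i
    using that v[OF that] by (intro eq_vecI) (auto simp: W_def)
  have "det W \<noteq> 0" unfolding W_def using v indep by (rule det_rows_nonzero)
  then obtain k where k: "k \<in> carrier_vec n" "W *\<^sub>v k = vec n \<mu>"
    by (rule det_nonzero_solve[OF W]) auto
  define K where "K = mat_of_rows n [k]"
  have K: "K \<in> carrier_mat 1 n" unfolding K_def using mat_of_rows_carrier(1)[of n "[k]"] by simp
  have "(A + B * K) *\<^sub>v v i = l i \<cdot>\<^sub>v v i" if i: "i < n" for i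
  proof -
    have "k \<bullet> v i = \<mu> i"
      using arg_cong[OF k(2), of "\<lambda>u. u $ i"] i W Wrow[OF i] comm_scalar_prod[OF k(1) v[OF i]]
      by simp
    then have "K *\<^sub>v v i = vec 1 (\<lambda>_. \<mu> i)"
      using k by (intro eq_vecI) (auto simp: K_def)
    then have "B *\<^sub>v (K *\<^sub>v v i) = \<mu> i \<cdot>\<^sub>v col B 0"
      using B by (intro eq_vecI) (auto simp: scalar_prod_def)
    moreover have "(A + B * K) *\<^sub>v v i = A *\<^sub>v v i + B *\<^sub>v (K *\<^sub>v v i)"
      using A B K v[OF i] by (simp add: add_mult_distrib_mat_vec[where nr = n and nc = n])
    ultimately show ?thesis using eq[OF i] by simp
  qed
  with K that show ?thesis by blast
qed

section \<open>Spectrum and output support of diagonalizable matrices\<close>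

lemma spectrum_eqI:
  fixes M :: "'a :: field mat"
  assumes M: "M \<in> carrier_mat n n" and inj: "inj_on l {..<n}"
    and ev: "\<And>i. i < n \<Longrightarrow> eigenvalue M (l i)"
  shows "spectrum M = l ` {..<n}"
proof (rule card_seteq[symmetric])
  show "finite (spectrum M)" by (rule card_finite_spectrum[OF M])
  show "l ` {..<n} \<subseteq> spectrum M" using ev by (auto simp: spectrum_def)
  show "card (spectrum M) \<le> card (l ` {..<n})"
    using card_finite_spectrum(2)[OF M] card_image[OF inj] by simp
qed

text \<open>With x the sum of the \<alpha>_i v_i, the output at time t is the sum of the \<alpha>_i
  (c \<bullet> v_i) l_i^t. If it vanishes for all t < n, the Vandermonde argument kills every
  \<alpha>_i.\<close>

lemma eigenbasis_output_nonzero: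
  fixes M :: "'a :: field mat"
  assumes M: "M \<in> carrier_mat n n" and inj: "inj_on l {..<n}"
    and v: "\<And>i. i < n \<Longrightarrow> v i \<in> carrier_vec n"
    and indep: "\<And>w. w \<in> carrier_vec n \<Longrightarrow> \<forall>i<n. w \<bullet> v i = 0 \<Longrightarrow> w = 0\<^sub>v n"
    and ev: "\<And>i. i < n \<Longrightarrow> M *\<^sub>v v i = l i \<cdot>\<^sub>v v i"
    and c: "c \<in> carrier_vec n" "\<And>i. i < n \<Longrightarrow> c \<bullet> v i \<noteq> 0"
    and x: "x \<in> carrier_vec n" "x \<noteq> 0\<^sub>v n"
  shows "\<exists>t<n. c \<bullet> (M ^\<^sub>m t *\<^sub>v x) \<noteq> 0"
proof (rule ccontr)
  assume "\<not> ?thesis"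
  then have zero: "c \<bullet> (M ^\<^sub>m t *\<^sub>v x) = 0" if "t < n" for t using that by blast
  define V where "V = mat n n (\<lambda>(i, j). v j $ i)"
  have V: "V \<in> carrier_mat n n" by (simp add: V_def)
  have Vcol: "col V i = v i" if "i < n" for i
    using that v[OF that] by (intro eq_vecI) (auto simp: V_def)
  have "det (mat n n (\<lambda>(i, j). v i $ j)) \<noteq> 0" using v indep by (rule det_rows_nonzero)
  also have "mat n n (\<lambda>(i, j). v i $ j) = transpose_mat V"
    by (intro eq_matI) (auto simp: V_def)
  finally have "det V \<noteq> 0" unfolding det_transpose[OF V] .
  then obtain \<alpha> where \<alpha>: "\<alpha> \<in> carrier_vec n" "V *\<^sub>v \<alpha> = x"
    by (rule det_nonzero_solve[OF V _ x(1)])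
  have pow: "M ^\<^sub>m t *\<^sub>v v i = l i ^ t \<cdot>\<^sub>v v i" if i: "i < n" for t i
  proof (cases "v i = 0\<^sub>v n")
    case True
    then show ?thesis using c i by (metis scalar_prod_right_zero)
  next
    case False
    then show ?thesis
      using eigenvector_pow[OF M, of "v i" "l i" t] ev[OF i] v[OF i] M
      by (auto simp: eigenvector_def)
  qed
  have "(\<Sum>i<n. \<alpha> $ i * (c \<bullet> v i) * l i ^ t) = 0" if t: "t < n" for t
  proof -
    have Mt: "M ^\<^sub>m t \<in> carrier_mat n n" using M by simp
    \<comment> \<open>Moving the power of \<open>M\<close> onto \<open>c\<close> turns the output at
      time \<open>t\<close> into one functional, which is then expanded along the columns of
      \<open>V\<close>.\<close>
    define d where "d = transpose_mat (M ^\<^sub>m t) *\<^sub>v c"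
    have d: "d \<in> carrier_vec n" using Mt c(1) unfolding d_def
      by (intro mult_mat_vec_carrier[of _ n n]) auto
    have dv: "d \<bullet> y = c \<bullet> (M ^\<^sub>m t *\<^sub>v y)" if "y \<in> carrier_vec n" for y
      unfolding d_def by (rule transpose_vec_mult_scalar[OF Mt that c(1)])
    have "0 = d \<bullet> (V *\<^sub>v \<alpha>)" using dv zero[OF t] \<alpha> x by simp
    also have "\<dots> = (transpose_mat V *\<^sub>v d) \<bullet> \<alpha>"
      by (rule transpose_vec_mult_scalar[OF V \<alpha>(1) d, symmetric])
    also have "\<dots> = (\<Sum>i<n. (v i \<bullet> d) * \<alpha> $ i)"
      using \<alpha>(1) V Vcol by (simp add: scalar_prod_def[of _ \<alpha>] atLeast0LessThan)
    also have "\<dots> = (\<Sum>i<n. \<alpha> $ i * (c \<bullet> v i) * l i ^ t)"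
    proof (rule sum.cong[OF refl])
      fix i assume "i \<in> {..<n}"
      then have i: "i < n" by simp
      have "v i \<bullet> d = c \<bullet> (l i ^ t \<cdot>\<^sub>v v i)"
        using comm_scalar_prod[OF v[OF i] d] dv[OF v[OF i]] pow[OF i] by simp
      then show "(v i \<bullet> d) * \<alpha> $ i = \<alpha> $ i * (c \<bullet> v i) * l i ^ t"
        using c(1) v[OF i] by (simp add: mult_ac)
    qed
    finally show ?thesis by simp
  qed
  from vandermonde_kernel[OF inj this] c(2) have "\<alpha> $ i = 0" if "i < n" for i
    using that by fastforce
  then have "\<alpha> = 0\<^sub>v n" using \<alpha>(1) by (intro eq_vecI) auto
  then have "x = 0\<^sub>v n" using \<alpha>(2) V by (auto intro!: eq_vecI)
  with x show False by simp
qed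

text \<open>A real closed loop has a conjugation-invariant spectrum, so the chosen set must be
  invariant too. The bound on nonzero rows is also forced: otherwise these rows split into two error
  sets of admissible size, confusing zero with a nonzero state for every \<open>K\<close>. As the
  \<open>l i\<close> are distinct, equality of spectra as sets makes every eigenvalue
  simple.\<close>

theorem proposition4:
  fixes n p :: nat and A B C :: "real mat"
  assumes "n \<ge> 1" and "p \<ge> 1"
    and "A \<in> carrier_mat n n" and "B \<in> carrier_mat n 1" and "C \<in> carrier_mat p n"
    and "controllable A B"
    and "2 * \<lceil>real p / 2 - 1\<rceil> < int (card {i. i < p \<and> row C i \<noteq> 0\<^sub>v n})"
  shows "\<exists>F :: complex set. finite F \<and>
    (\<forall>l :: nat \<Rightarrow> complex.
       (\<forall>i<n. l i \<notin> F) \<and>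
       inj_on (\<lambda>i. cmod (l i)) {..<n} \<and>
       (\<forall>i<n. cnj (l i) \<in> l ` {..<n}) \<longrightarrow>
       (\<exists>K \<in> carrier_mat 1 n.
          spectrum (map_mat complex_of_real (A + B * K)) = l ` {..<n} \<and>
          is_num_correctable_errors (A + B * K) C n (nat \<lceil>real p / 2 - 1\<rceil>)))"
proof -
  note n = assms(1) and A = assms(3) and B = assms(4) and C = assms(5)
  define q where "q = nat \<lceil>real p / 2 - 1\<rceil>"
  define J where "J = {j. j < p \<and> row C j \<noteq> 0\<^sub>v n}"
  \<comment> \<open>Since \<open>p \<ge> 1\<close>, the ceiling is nonnegative and
    \<open>nat\<close> does not change it.\<close>
  have q: "2 * q < card J"
    using assms(2,7) unfolding q_def J_def[symmetric] by linarith
  define b where "b = col B 0"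
  have b: "b \<in> carrier_vec n" using B by (auto simp: b_def)
  note indep = controllable_krylov_indep[OF A B assms(6), folded b_def]
  obtain a where a: "\<And>i. i < n \<Longrightarrow> krylov A b n $ i = - (\<Sum>j<n. a j * krylov A b j $ i)"
    using controllable_krylov_dep[OF A B assms(6), folded b_def] by blast
  define N where "N w = resolvent_poly A b a n w" for w
  define u where "u x = resolvent_vec A b a n x" for x
  have u: "u x \<in> carrier_vec n" for x unfolding u_def by (rule resolvent_vec_carrier)
  have Nu: "w \<bullet> u x = poly (N w) x" if "w \<in> carrier_vec n" for w x
    unfolding u_def N_def by (rule scalar_prod_resolvent_vec[OF A b that])
  have N0: "N w \<noteq> 0" if "w \<in> carrier_vec n" "w \<noteq> 0\<^sub>v n" for w
    unfolding N_def using resolvent_poly_nonzero[OF indep that] .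
  \<comment> \<open>Real roots suffice, because the admissible \<open>l i\<close> turn out to be
    real.\<close>
  define F where "F = (\<Union>j\<in>J. complex_of_real ` {x. poly (N (row C j)) x = 0})"
  have C_row: "row C j \<in> carrier_vec n" for j using C by auto
  have "finite F"
    unfolding F_def using C_row N0 by (auto simp: J_def intro!: poly_roots_finite)
  moreover have "\<exists>K \<in> carrier_mat 1 n.
      spectrum (map_mat complex_of_real (A + B * K)) = l ` {..<n} \<and>
      is_num_correctable_errors (A + B * K) C n q"
    if lF: "\<forall>i<n. l i \<notin> F" and mag: "inj_on (\<lambda>i. cmod (l i)) {..<n}"
      and conj: "\<forall>i<n. cnj (l i) \<in> l ` {..<n}" for l :: "nat \<Rightarrow> complex"
  proof -
    text \<open>A number and its conjugate have the same magnitude, so all \<open>l i\<close> are real.\<close>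
    have "cnj (l i) = l i" if i: "i < n" for i
    proof -
      obtain j where j: "j < n" "cnj (l i) = l j" using conj i by auto
      then have "cmod (l i) = cmod (l j)" by (metis complex_mod_cnj)
      with mag i j have "i = j" by (auto dest: inj_onD)
      with j show ?thesis by simp
    qed
    then have Im: "Im (l i) = 0" if "i < n" for i
      using that by (simp add: complex_eq_iff)
    define r where "r i = Re (l i)" for i
    have r: "l i = complex_of_real (r i)" if "i < n" for i
      using Im[OF that] by (simp add: r_def complex_eq_iff)
    have inj_l: "inj_on l {..<n}" using mag by (auto simp: inj_on_def)
    have inj_r: "inj_on r {..<n}"
      using inj_l r by (auto simp: inj_on_def)
    define v where "v i = u (r i)" for i
    have v: "v i \<in> carrier_vec n" for i unfolding v_def by (rule u)
    have v_indep: "w = 0\<^sub>v n" if w: "w \<in> carrier_vec n" and zero: "\<forall>i<n. w \<bullet> v i = 0" for w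
    proof (rule ccontr)
      assume "w \<noteq> 0\<^sub>v n"
      with w have nz: "N w \<noteq> 0" by (rule N0)
      \<comment> \<open>The \<open>n\<close> distinct numbers \<open>r i\<close> would be roots of a
        nonzero polynomial of degree less than \<open>n\<close>.\<close>
      have "n = card (r ` {..<n})" using card_image[OF inj_r] by simp
      also have "\<dots> \<le> card {x. poly (N w) x = 0}"
        using zero Nu[OF w] nz by (intro card_mono poly_roots_finite) (auto simp: v_def)
      also have "\<dots> \<le> degree (N w)" by (rule card_poly_roots_bound[OF nz])
      also have "\<dots> < n" unfolding N_def by (rule degree_resolvent_poly[OF n])
      finally show False by simp
    qed
    have res: "A *\<^sub>v v i + poly (horner a n n) (r i) \<cdot>\<^sub>v col B 0 = r i \<cdot>\<^sub>v v i" for i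
      using resolvent_vec_eq[OF A b a] unfolding v_def u_def b_def by simp
    obtain K where K: "K \<in> carrier_mat 1 n"
      and ev: "\<And>i. i < n \<Longrightarrow> (A + B * K) *\<^sub>v v i = r i \<cdot>\<^sub>v v i"
      by (rule state_feedback_eigenvectors[where v = v, OF A B v v_indep res that])
    define M where "M = A + B * K"
    have M: "M \<in> carrier_mat n n" using A B K by (simp add: M_def)
    have cv: "row C j \<bullet> v i \<noteq> 0" if "i < n" "j \<in> J" for i j
      using lF r that Nu[OF C_row] unfolding F_def v_def by fastforce
    \<comment> \<open>An eigenvector must be nonzero; any row indexed by \<open>J\<close> witnesses
      this for \<open>v i\<close>.\<close>
    have "J \<noteq> {}" using q by auto
    then have "v i \<noteq> 0\<^sub>v n" if "i < n" for i
      using cv[OF that] C_row by (metis ex_in_conv scalar_prod_right_zero)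
    then have "eigenvector M (v i) (r i)" if "i < n" for i
      using that ev v M unfolding eigenvector_def M_def by auto
    then have "eigenvalue (map_mat complex_of_real M) (l i)" if "i < n" for i
      using that r of_real_hom.eigenvector_hom[OF M] unfolding eigenvalue_def by metis
    then have "spectrum (map_mat complex_of_real M) = l ` {..<n}"
      using M inj_l by (intro spectrum_eqI) auto
    moreover have "errors_correctable M C n q"
    proof (rule errors_correctableI[OF M C])
      fix x :: "real vec" assume x: "x \<in> carrier_vec n" "x \<noteq> 0\<^sub>v n"
      have "\<exists>t<n. ((C * M ^\<^sub>m t) *\<^sub>v x) $ j \<noteq> 0" if j: "j \<in> J" for j
      proof -
        obtain t where t: "t < n" "row C j \<bullet> (M ^\<^sub>m t *\<^sub>v x) \<noteq> 0"
          using eigenbasis_output_nonzero[OF M inj_r v v_indep ev[folded M_def] C_row cv[OF _ j] x]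
          by blast
        have "(C * M ^\<^sub>m t) *\<^sub>v x = C *\<^sub>v (M ^\<^sub>m t *\<^sub>v x)"
          using C M x by (intro assoc_mult_mat_vec) auto
        then have "((C * M ^\<^sub>m t) *\<^sub>v x) $ j = row C j \<bullet> (M ^\<^sub>m t *\<^sub>v x)"
          using j C by (simp add: J_def)
        with t show ?thesis by metis
      qed
      then have "J \<subseteq> {j. j < p \<and> (\<exists>t<n. ((C * M ^\<^sub>m t) *\<^sub>v x) $ j \<noteq> 0)}"
        by (auto simp: J_def)
      then have "card J \<le> card {j. j < p \<and> (\<exists>t<n. ((C * M ^\<^sub>m t) *\<^sub>v x) $ j \<noteq> 0)}"
        by (intro card_mono) auto
      with q show "2 * q < card {j. j < p \<and> (\<exists>t<n. ((C * M ^\<^sub>m t) *\<^sub>v x) $ j \<noteq> 0)}" by simp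
    qed
    \<comment> \<open>For integers, \<open>2 * q' < p\<close> is equivalent to the bound by the
      ceiling.\<close>
    moreover have "q' \<le> q" if "errors_correctable M C n q'" for q'
      using errors_correctable_imp_less[OF M C n that] unfolding q_def by linarith
    ultimately show ?thesis
      using K unfolding M_def is_num_correctable_errors_def by blast
  qed
  ultimately show ?thesis unfolding q_def by blast
qed

end
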